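(* Let $G$ be a countably infinite amenable residually finite group and let $\mathscr A$ be a finite set. The family of all Toeplitz configurations in $\mathscr A^G$ is path-connected with respect to $D_W$: for any two Toeplitz configurations $\underline z,\underline z'\in\mathscr A^G$ there is a $D_W$-continuous map $f$ from $[0,1]$ to the set of Toeplitz configurations in $\mathscr A^G$ with $f(0)=\underline z$ and $f(1)=\underline z'$.
   Context: $G$ acts on $\mathscr A^G$ by the shift $(h,(x_g)_{g\in G})\mapsto(x_{gh})_{g\in G}$, and $\mathscr A^G$ carries a compatible metric $\rho$ of diameter at most $1$ for the product topology such that $\mathrm{dist}([a],[b])>1/2$ for $a\ne b$ in $\mathscr A$, where $[a]=\{\underline x\in\mathscr A^G:x_e=a\}$. A (left) Følner sequence is a sequence $\{F_n\}$ of non-empty finite subsets of $G$ with $|gF_n\triangle F_n|/|F_n|\to0$ for every $g\in G$. Weyl pseudometric: $D_W(x,z)=\limsup_{n\to\infty}\frac1{|F_n|}\sup_{g\in G}\sum_{f\in F_ng}\rho(fx,fz)$ for $x,z\in\mathscr A^G$ and a Følner sequence $\{F_n\}$ (independent of the Følner sequence). $\underline x\in\mathscr A^G$ is a Toeplitz configuration if for every $g\in G$ there is a finite index subgroup $H$ of $G$ such that $\underline x(\gamma g)=\underline x(g)$ for all $\gamma\in H$. A group is residually finite if it has a nested sequence of finite index normal subgroups with trivial intersection. *)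

theory Defs
  imports "HOL-Analysis.Analysis" "HOL-Algebra.Coset"
begin

subsection \<open>Amenable and residually finite groups\<close>

definition finite_index_subgroup :: "('g, 'b) monoid_scheme \<Rightarrow> 'g set \<Rightarrow> bool" where
  "finite_index_subgroup G H \<longleftrightarrow> subgroup H G \<and> finite (rcosets\<^bsub>G\<^esub> H)"

definition residually_finite :: "('g, 'b) monoid_scheme \<Rightarrow> bool" where
  "residually_finite G \<longleftrightarrow>
     (\<exists>N :: nat \<Rightarrow> 'g set.
        (\<forall>n. N n \<lhd> G \<and> finite_index_subgroup G (N n)) \<and>
        (\<forall>n. N (Suc n) \<subseteq> N n) \<and>
        (\<Inter>n. N n) = {\<one>\<^bsub>G\<^esub>})"

definition folner_sequence :: "('g, 'b) monoid_scheme \<Rightarrow> (nat \<Rightarrow> 'g set) \<Rightarrow> bool" where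
  "folner_sequence G F \<longleftrightarrow>
     (\<forall>n. F n \<noteq> {} \<and> finite (F n) \<and> F n \<subseteq> carrier G) \<and>
     (\<forall>g\<in>carrier G.
        (\<lambda>n. real (card (sym_diff (g <#\<^bsub>G\<^esub> F n) (F n))) / real (card (F n))) \<longlonglongrightarrow> 0)"

text \<open>Amenability of a countable group, in Folner's form.\<close>

definition amenable :: "('g, 'b) monoid_scheme \<Rightarrow> bool" where
  "amenable G \<longleftrightarrow> (\<exists>F. folner_sequence G F)"


subsection \<open>Configurations and the shift\<close>

text \<open>Configurations are extensional functions, i.e. \<^term>\<open>undefined\<close> outside the carrier, so
  that equality of configurations is equality of functions.\<close>

definition configurations :: "('g, 'b) monoid_scheme \<Rightarrow> 'a set \<Rightarrow> ('g \<Rightarrow> 'a) set" where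
  "configurations G A = carrier G \<rightarrow>\<^sub>E A"

definition shift :: "('g, 'b) monoid_scheme \<Rightarrow> 'g \<Rightarrow> ('g \<Rightarrow> 'a) \<Rightarrow> ('g \<Rightarrow> 'a)" where
  "shift G h x = (\<lambda>g\<in>carrier G. x (g \<otimes>\<^bsub>G\<^esub> h))"

definition cylinder :: "('g, 'b) monoid_scheme \<Rightarrow> 'a set \<Rightarrow> 'a \<Rightarrow> ('g \<Rightarrow> 'a) set" where
  "cylinder G A a = {x \<in> configurations G A. x \<one>\<^bsub>G\<^esub> = a}"

definition toeplitz :: "('g, 'b) monoid_scheme \<Rightarrow> 'a set \<Rightarrow> ('g \<Rightarrow> 'a) set" where
  "toeplitz G A = {x \<in> configurations G A.
     \<forall>g\<in>carrier G. \<exists>H. finite_index_subgroup G H \<and> (\<forall>\<gamma>\<in>H. x (\<gamma> \<otimes>\<^bsub>G\<^esub> g) = x g)}"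


subsection \<open>The metric on configurations and the Weyl pseudometric\<close>

definition set_distance :: "('c \<Rightarrow> 'c \<Rightarrow> real) \<Rightarrow> 'c set \<Rightarrow> 'c set \<Rightarrow> real" where
  "set_distance \<rho> S T = (INF (x, y)\<in>S \<times> T. \<rho> x y)"

definition admissible_metric ::
  "('g, 'b) monoid_scheme \<Rightarrow> 'a set \<Rightarrow> (('g \<Rightarrow> 'a) \<Rightarrow> ('g \<Rightarrow> 'a) \<Rightarrow> real) \<Rightarrow> bool" where
  "admissible_metric G A \<rho> \<longleftrightarrow>
     Metric_space (configurations G A) \<rho> \<and>
     Metric_space.mtopology (configurations G A) \<rho>
       = product_topology (\<lambda>_. discrete_topology A) (carrier G) \<and>
     (\<forall>x\<in>configurations G A. \<forall>y\<in>configurations G A. \<rho> x y \<le> 1) \<and>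
     (\<forall>a\<in>A. \<forall>b\<in>A. a \<noteq> b \<longrightarrow> set_distance \<rho> (cylinder G A a) (cylinder G A b) > 1/2)"

text \<open>For an admissible metric and configurations \<open>x\<close>, \<open>z\<close>, each sum lies between \<open>0\<close> and
  \<open>card (F n)\<close>. Hence the supremum is a genuine real supremum, and the upper limit, taken in the
  extended reals, lies in \<open>[0, 1]\<close>.\<close>

definition weyl_dist ::
  "('g, 'b) monoid_scheme \<Rightarrow> (nat \<Rightarrow> 'g set) \<Rightarrow> (('g \<Rightarrow> 'a) \<Rightarrow> ('g \<Rightarrow> 'a) \<Rightarrow> real)
    \<Rightarrow> ('g \<Rightarrow> 'a) \<Rightarrow> ('g \<Rightarrow> 'a) \<Rightarrow> real" where
  "weyl_dist G F \<rho> x z = real_of_ereal (limsup (\<lambda>n. ereal (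
     1 / real (card (F n)) *
     (SUP g\<in>carrier G. \<Sum>f\<in>F n #>\<^bsub>G\<^esub> g. \<rho> (shift G f x) (shift G f z)))))"

text \<open>The library has no carrier-based pseudometric spaces, so continuity of a map into one is
  spelled out.\<close>

definition pseudometric_continuous_on ::
  "('t::topological_space) set \<Rightarrow> ('c \<Rightarrow> 'c \<Rightarrow> real) \<Rightarrow> ('t \<Rightarrow> 'c) \<Rightarrow> bool" where
  "pseudometric_continuous_on T D f \<longleftrightarrow>
     (\<forall>t\<in>T. ((\<lambda>s. D (f s) (f t)) \<longlongrightarrow> 0) (at t within T))"

end

theory Submission
  imports Defs
begin

text \<open>
  The path switches from \<open>z\<close> to \<open>z'\<close> one region of the group at a time: \<open>interpolate z z' t\<close> agrees
  with \<open>z'\<close> where a certain function \<open>height\<close> from the group to \<open>[0, 1)\<close> is below \<open>t\<close>, and with \<open>z\<close>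
  elsewhere. Let \<open>N n\<close> be the chain given by residual finiteness. The height has to reconcile two
  demands.

  For the interpolants to be Toeplitz, the truth value of \<open>height h < t\<close> must be constant on some
  coset \<open>N n #> g\<close> around each \<open>g\<close> (\<open>height_locally_decided\<close>). A height that is merely continuous for
  the topology of these cosets would not do, since \<open>height g\<close> may equal \<open>t\<close>; so every \<open>g\<close> is made
  a local minimum of the height as well.

  For the path to be continuous, the set where the interpolants at \<open>s\<close> and \<open>t\<close> differ, which lies in
  \<open>{g. s \<le> height g < t}\<close>, must have small upper Banach density when \<open>t - s\<close> is small. It
  suffices that elements of nearly equal height lie in a common coset of \<open>N n\<close>
  (\<open>height_close_imp_same_coset\<close>): if the finitely many elements of \<open>T\<close> lie in different left cosets
  of \<open>N n\<close>, the translates of the band by the elements of \<open>T\<close> are disjoint, and a Folner set, being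
  almost invariant, meets each of them about equally often, hence has a proportion of at most about
  \<open>1 / card T\<close> in the band (\<open>disjoint_translates_density_le\<close>).

  The height comes from an enumeration \<open>e\<close> of the group. The leader of a coset is the first index
  in the enumeration whose element belongs to it. Along the shrinking cosets \<open>N n #> g\<close> the leaders
  increase and stabilise at an index of \<open>g\<close>, so they form a finite set, and \<open>height g\<close> is the number
  with ternary digits 0 and 1 that encodes this set. A point \<open>h\<close> close to \<open>g\<close> shares all leaders of \<open>g\<close>
  and adds only large ones, which makes \<open>g\<close> a local minimum; conversely an approximate value of the
  height determines the small leaders, hence the coset.

  The passage from density to the Weyl pseudometric uses compactness of the configuration space:
  two configurations that agree on a large finite window are uniformly close.
\<close>

no_notation subset_mset (infix "<#" 50)


section \<open>Ternary weights of finite sets of naturals\<close>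

definition ternary :: "nat set \<Rightarrow> real" where
  "ternary P = (\<Sum>i\<in>P. (1/3) ^ Suc i)"

lemma ternary_nonneg: "0 \<le> ternary P"
  by (simp add: ternary_def sum_nonneg)

text \<open>The factor \<open>1/2\<close>, from the geometric series, leaves a gap between digit 0 followed by any tail
  and digit 1; base 2 would leave none, and nearby values could then have different digits.\<close>

lemma ternary_tail:
  assumes "finite P" "P \<subseteq> {m..}"
  shows "ternary P \<le> (1/3) ^ m / 2"
proof -
  obtain b where b: "P \<subseteq> {..<b}"
    using assms(1) finite_nat_iff_bounded by blast
  have sub: "P \<subseteq> {m..<m+b}"
    using assms(2) b by force
  have "ternary {m..<m+k} = ((1/3) ^ m - (1/3) ^ (m+k)) / 2" for k
  proof (induction k)
    case (Suc k)
    have "ternary {m..<m + Suc k} = ternary {m..<m+k} + (1/3) ^ Suc (m+k)"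
      by (simp add: ternary_def)
    then show ?case
      using Suc.IH by (simp add: diff_divide_distrib)
  qed (simp add: ternary_def)
  then have "ternary {m..<m+b} \<le> (1/3) ^ m / 2"
    by simp
  moreover have "ternary P \<le> ternary {m..<m+b}"
    unfolding ternary_def using sub by (intro sum_mono2) auto
  ultimately show ?thesis
    by simp
qed

lemma ternary_split:
  assumes "finite P"
  shows "ternary P = ternary (P \<inter> {..<i}) + ternary (P \<inter> {i..})"
  unfolding ternary_def
  by (subst sum.union_disjoint[symmetric]) (use assms in \<open>auto intro!: sum.cong\<close>)

lemma ternary_gap:
  assumes fin: "finite P" "finite Q" and i: "i \<in> P" "i \<notin> Q"
    and agree: "P \<inter> {..<i} = Q \<inter> {..<i}"
  shows "ternary P - ternary Q \<ge> (1/3) ^ Suc i / 2"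
proof -
  have "ternary (Q \<inter> {i..}) \<le> (1/3) ^ Suc i / 2"
  proof (rule ternary_tail)
    show "Q \<inter> {i..} \<subseteq> {Suc i..}"
      using i(2) by (auto simp: Suc_le_eq order_le_less)
  qed (use fin in auto)
  moreover have "(1/3) ^ Suc i \<le> ternary (P \<inter> {i..})"
    unfolding ternary_def by (rule member_le_sum) (use fin i in auto)
  ultimately show ?thesis
    using ternary_split[OF fin(1), of i] ternary_split[OF fin(2), of i] agree by simp
qed

text \<open>At the first place \<open>i\<close> where the sets differ, \<open>ternary_gap\<close> forces a distance of at least
  half the weight of \<open>i\<close>.\<close>

lemma ternary_close_imp_agree:
  assumes fin: "finite P" "finite Q" and close: "\<bar>ternary P - ternary Q\<bar> < (1/3) ^ Suc K / 2"
  shows "P \<inter> {..K} = Q \<inter> {..K}"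
proof (rule ccontr)
  assume neq: "P \<inter> {..K} \<noteq> Q \<inter> {..K}"
  define differs where "differs i \<longleftrightarrow> (i \<in> P) \<noteq> (i \<in> Q)" for i
  define i where "i = (LEAST i. differs i)"
  obtain j where j: "differs j" "j \<le> K"
    using neq unfolding differs_def by blast
  have "differs i" and iK: "i \<le> K"
    unfolding i_def using j by (auto intro: LeastI Least_le[THEN order_trans])
  have "\<not> differs k" if "k < i" for k
    using that not_less_Least unfolding i_def by blast
  then have agree: "P \<inter> {..<i} = Q \<inter> {..<i}"
    unfolding differs_def by blast
  have "(1/3) ^ Suc K / 2 \<le> ((1/3) ^ Suc i / 2 :: real)"
    using iK by (simp add: power_decreasing)
  moreover have "(1/3) ^ Suc i / 2 \<le> \<bar>ternary P - ternary Q\<bar>"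
    using \<open>differs i\<close> ternary_gap[OF fin _ _ agree] ternary_gap[OF fin(2,1) _ _ agree[symmetric]]
    unfolding differs_def by (cases "i \<in> P") (simp_all add: abs_if)
  ultimately show False
    using close by linarith
qed


section \<open>A height on a residually finite group\<close>

locale residual_chain = group G for G (structure) +
  fixes N :: "nat \<Rightarrow> 'a set" and e :: "nat \<Rightarrow> 'a"
  assumes finite_index: "finite_index_subgroup G (N n)"
    and decreasing: "N (Suc n) \<subseteq> N n"
    and Inter_trivial: "(\<Inter>n. N n) = {\<one>}"
    and enumeration: "range e = carrier G"
begin

definition leader :: "nat \<Rightarrow> 'a \<Rightarrow> nat" where
  "leader n g = (LEAST i. e i \<in> N n #> g)"

text \<open>A leader is kept as an index rather than a group element, so that the set of leaders can be
  encoded as a number.\<close>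

definition leaders :: "'a \<Rightarrow> nat set" where
  "leaders g = range (\<lambda>n. leader n g)"

definition height :: "'a \<Rightarrow> real" where
  "height g = ternary (leaders g)"

lemma subgroup_N: "subgroup (N n) G"
  using finite_index by (simp add: finite_index_subgroup_def)

lemma antimono_N: "k \<le> n \<Longrightarrow> N n \<subseteq> N k"
  using lift_Suc_antimono_le[of N, OF decreasing] .

lemma coset_eq: "h \<in> N n #> g \<Longrightarrow> g \<in> carrier G \<Longrightarrow> N n #> h = N n #> g"
  using repr_independence[OF _ _ subgroup_N] by blast

lemma coset_antimono: "k \<le> n \<Longrightarrow> N n #> g \<subseteq> N k #> g"
  using antimono_N unfolding r_coset_def by blast

lemma coset_carrier: "h \<in> N n #> g \<Longrightarrow> g \<in> carrier G \<Longrightarrow> h \<in> carrier G"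
  using r_coset_subset_G subgroup.subset[OF subgroup_N] by blast

lemma self_in_coset: "g \<in> carrier G \<Longrightarrow> g \<in> N n #> g"
  using rcos_self[OF _ subgroup_N] .

lemma coset_sym: "h \<in> N n #> g \<Longrightarrow> g \<in> carrier G \<Longrightarrow> g \<in> N n #> h"
  using coset_eq self_in_coset by blast

text \<open>The only form in which the trivial intersection of the chain is used.\<close>

lemma finite_escapes:
  assumes "finite T"
  shows "\<exists>n. T \<inter> N n \<subseteq> {\<one>}"
  using assms
proof induction
  case (insert t T)
  obtain n where n: "T \<inter> N n \<subseteq> {\<one>}"
    using insert.IH by blast
  obtain k where k: "t \<in> N k \<longrightarrow> t = \<one>"
    using Inter_trivial by blast
  show ?case
    using n k antimono_N[of n "max n k"] antimono_N[of k "max n k"]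
    by (intro exI[of _ "max n k"]) auto
qed simp

lemma coset_isolates:
  assumes g: "g \<in> carrier G"
  shows "\<exists>n. \<forall>j\<le>M. e j \<in> N n #> g \<longrightarrow> e j = g"
proof -
  obtain n where n: "(\<lambda>j. e j \<otimes> inv g) ` {..M} \<inter> N n \<subseteq> {\<one>}"
    using finite_escapes by blast
  have "e j = g" if "j \<le> M" "e j \<in> N n #> g" for j
  proof -
    have ej: "e j \<in> carrier G"
      using enumeration by blast
    have "e j \<otimes> inv g \<in> N n"
      using that(2) g ej subgroup.rcos_module_imp[OF subgroup_N is_group g] by blast
    then have "e j \<otimes> inv g = \<one>"
      using n that(1) by blast
    then show ?thesis
      using g ej inv_equality[of "e j" "inv g"] by simp
  qed
  then show ?thesis
    by blast
qed

lemma leader_in_coset: "g \<in> carrier G \<Longrightarrow> e (leader n g) \<in> N n #> g"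
  unfolding leader_def using self_in_coset enumeration by (metis LeastI rangeE)

lemma leader_le: "e i \<in> N n #> g \<Longrightarrow> leader n g \<le> i"
  unfolding leader_def by (rule Least_le)

lemma leader_mono: "g \<in> carrier G \<Longrightarrow> k \<le> n \<Longrightarrow> leader k g \<le> leader n g"
  using leader_le leader_in_coset coset_antimono by blast

lemma leader_cong: "h \<in> N n #> g \<Longrightarrow> g \<in> carrier G \<Longrightarrow> k \<le> n \<Longrightarrow> leader k h = leader k g"
  using coset_eq[of h k g] coset_antimono[of k n g] unfolding leader_def by auto

lemma finite_leaders:
  assumes "g \<in> carrier G"
  shows "finite (leaders g)"
proof -
  obtain i where "e i = g"
    using assms enumeration by (metis rangeE)
  then have "leaders g \<subseteq> {..i}"
    using leader_le self_in_coset[OF assms] unfolding leaders_def by auto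
  then show ?thesis
    using finite_subset by blast
qed

text \<open>Close to \<open>g\<close> there are no elements with small index except \<open>g\<close> itself, so the leaders of the
  small cosets of a nearby \<open>h\<close> are either an index of \<open>g\<close> or large; the leaders of the big cosets are
  the same for \<open>g\<close> and \<open>h\<close>.\<close>

lemma leaders_locally_grow:
  assumes g: "g \<in> carrier G"
  shows "\<exists>n. \<forall>h\<in>N n #> g. leaders g \<subseteq> leaders h \<and> leaders h - leaders g \<subseteq> {K..}"
proof -
  obtain i where i: "e i = g"
    using g enumeration by (metis rangeE)
  define M where "M = max i K"
  obtain n where n: "\<And>j. j \<le> M \<Longrightarrow> e j \<in> N n #> g \<Longrightarrow> e j = g"
    using coset_isolates[OF g] by blast
  define l where "l = leader n g"
  have "l \<le> i"
    unfolding l_def using i self_in_coset[OF g] leader_le by blast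
  then have el: "e l = g"
    using n[of l] leader_in_coset[OF g, of n] unfolding l_def M_def by simp
  \<comment> \<open>From stage \<open>n\<close> on, the leader of \<open>g\<close> is its least index, so no later stage adds a leader.\<close>
  have stable: "leader k g = l" if "n \<le> k" for k
    using leader_le[of l k g] el self_in_coset[OF g] leader_mono[OF g that] unfolding l_def
    by (simp add: antisym)
  have "leaders g \<subseteq> leaders h \<and> leaders h - leaders g \<subseteq> {K..}" if h: "h \<in> N n #> g" for h
  proof -
    have hG: "h \<in> carrier G"
      using coset_carrier[OF h g] .
    have same: "leader k g = leader k h" if "k \<le> n" for k
      using leader_cong[OF h g that] by simp
    have "leader k g \<in> leaders h" for k
    proof (cases "k \<le> n")
      case True
      then show ?thesis
        using same unfolding leaders_def by simp
    next
      case False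
      then have "leader k g = leader n h"
        using stable[of k] same[of n] by (simp add: l_def)
      then show ?thesis
        unfolding leaders_def by simp
    qed
    moreover have "K \<le> leader k h" if new: "leader k h \<notin> leaders g" for k
    proof (rule ccontr)
      assume small: "\<not> K \<le> leader k h"
      have nk: "n \<le> k"
        using new same[of k] unfolding leaders_def by (metis linear rangeI)
      have "e (leader k h) \<in> N n #> g"
        using leader_in_coset[OF hG] coset_antimono[OF nk] coset_eq[OF h g] by blast
      then have "e (leader k h) = g"
        using n small unfolding M_def by simp
      then have "leader k h \<le> l"
        using leader_in_coset[OF hG, of k] el by (intro leader_le) simp
      moreover have "l \<le> leader k h"
        using leader_mono[OF hG nk] same[of n] unfolding l_def by simp
      ultimately show False
        using new unfolding leaders_def l_def by simp
    qed
    ultimately show ?thesis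
      unfolding leaders_def by blast
  qed
  then show ?thesis
    by blast
qed

text \<open>Finite index enters here: a bound on the leaders at stage \<open>n\<close> makes finitely many digits
  sufficient to determine the coset at that stage.\<close>

lemma leader_bounded: "\<exists>K. \<forall>g\<in>carrier G. leader n g \<le> K"
proof -
  have "finite ((\<lambda>C. LEAST i. e i \<in> C) ` (rcosets (N n)))"
    using finite_index by (simp add: finite_index_subgroup_def)
  moreover have "leader n g \<in> (\<lambda>C. LEAST i. e i \<in> C) ` (rcosets (N n))" if "g \<in> carrier G" for g
    unfolding leader_def RCOSETS_def using that by blast
  ultimately show ?thesis
    using Max_ge by blast
qed

text \<open>Although a set of leaders does not record which stage contributed which element, its small part
  still identifies the coset at stage \<open>n\<close>. The leader of \<open>g\<close> at stage \<open>n\<close> is also a leader of \<open>h\<close>, at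
  some stage \<open>k\<close>. If \<open>n \<le> k\<close>, it indexes an element common to both cosets; otherwise monotonicity makes
  it at most the leader of \<open>h\<close> at stage \<open>n\<close>. Exchanging \<open>g\<close> and \<open>h\<close>, the leaders at stage \<open>n\<close> coincide,
  and again the cosets share an element.\<close>

lemma leaders_agree_imp_same_coset:
  "\<exists>K. \<forall>g\<in>carrier G. \<forall>h\<in>carrier G.
     leaders g \<inter> {..K} = leaders h \<inter> {..K} \<longrightarrow> g \<in> N n #> h"
proof -
  obtain K where K: "\<And>g. g \<in> carrier G \<Longrightarrow> leader n g \<le> K"
    using leader_bounded by blast
  have key: "g \<in> N n #> h \<or> leader n g \<le> leader n h"
    if g: "g \<in> carrier G" and h: "h \<in> carrier G"
      and eq: "leaders g \<inter> {..K} = leaders h \<inter> {..K}" for g h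
  proof -
    have "leader n g \<in> leaders h"
      using K[OF g] eq unfolding leaders_def by blast
    then obtain k where k: "leader n g = leader k h"
      unfolding leaders_def by blast
    show ?thesis
    proof (cases "n \<le> k")
      case True
      then have "e (leader n g) \<in> N n #> h"
        using k leader_in_coset[OF h, of k] coset_antimono[OF True] by auto
      then have "N n #> g = N n #> h"
        using coset_eq[OF leader_in_coset[OF g]] coset_eq[OF _ h] g by metis
      then show ?thesis
        using self_in_coset[OF g] by blast
    next
      case False
      then show ?thesis
        using k leader_mono[OF h, of k n] by simp
    qed
  qed
  have "g \<in> N n #> h"
    if g: "g \<in> carrier G" and h: "h \<in> carrier G"
      and eq: "leaders g \<inter> {..K} = leaders h \<inter> {..K}" for g h
  proof (rule ccontr)
    assume no: "g \<notin> N n #> h"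
    then have "h \<notin> N n #> g"
      using coset_sym g by blast
    then have "leader n g = leader n h"
      using key[OF g h eq] key[OF h g eq[symmetric]] no by simp
    then have "N n #> g = N n #> h"
      using coset_eq[OF leader_in_coset[OF g]] coset_eq[OF leader_in_coset[OF h]] g h by metis
    then show False
      using no self_in_coset[OF g] by blast
  qed
  then show ?thesis
    by blast
qed

lemma height_bounds: "g \<in> carrier G \<Longrightarrow> 0 \<le> height g \<and> height g < 1"
  using ternary_nonneg ternary_tail[OF finite_leaders, of g 0] unfolding height_def by simp

text \<open>On a small coset of \<open>g\<close> the height takes values in \<open>[height g, height g + \<delta>]\<close>. If
  \<open>height g \<ge> t\<close>, nearby heights are at least \<open>t\<close>; otherwise a small \<open>\<delta>\<close> keeps them below \<open>t\<close>.\<close>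

lemma height_locally_decided:
  assumes g: "g \<in> carrier G"
  shows "\<exists>n. \<forall>h\<in>N n #> g. height h < t \<longleftrightarrow> height g < t"
proof -
  obtain K where K: "height g < t \<Longrightarrow> (1/3::real) ^ K < t - height g"
    using real_arch_pow_inv[of "t - height g" "1/3"] by (cases "height g < t") auto
  obtain n where n: "\<And>h. h \<in> N n #> g \<Longrightarrow>
      leaders g \<subseteq> leaders h \<and> leaders h - leaders g \<subseteq> {K..}"
    using leaders_locally_grow[OF g] by blast
  have "height h < t \<longleftrightarrow> height g < t" if h: "h \<in> N n #> g" for h
  proof -
    have fin: "finite (leaders h)"
      using finite_leaders coset_carrier[OF h g] by blast
    have "height h = height g + ternary (leaders h - leaders g)"
      unfolding height_def ternary_def using sum.subset_diff[of "leaders g" "leaders h"] n[OF h] fin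
      by (simp add: add.commute)
    moreover have "ternary (leaders h - leaders g) \<le> (1/3) ^ K / 2"
      using n[OF h] fin by (intro ternary_tail) auto
    moreover have "0 < (1/3::real) ^ K"
      by simp
    ultimately show ?thesis
      using K ternary_nonneg[of "leaders h - leaders g"] by linarith
  qed
  then show ?thesis
    by blast
qed

lemma height_close_imp_same_coset:
  "\<exists>\<epsilon>>0. \<forall>g\<in>carrier G. \<forall>h\<in>carrier G. \<bar>height g - height h\<bar> < \<epsilon> \<longrightarrow> g \<in> N n #> h"
proof -
  obtain K where K: "\<forall>g\<in>carrier G. \<forall>h\<in>carrier G.
      leaders g \<inter> {..K} = leaders h \<inter> {..K} \<longrightarrow> g \<in> N n #> h"
    using leaders_agree_imp_same_coset[of n] ..
  have "g \<in> N n #> h"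
    if "g \<in> carrier G" "h \<in> carrier G" "\<bar>height g - height h\<bar> < (1/3) ^ Suc K / 2" for g h
    using K ternary_close_imp_agree[OF finite_leaders finite_leaders, OF that(1,2)] that
    unfolding height_def by simp
  moreover have "(0::real) < (1/3) ^ Suc K / 2"
    by simp
  ultimately show ?thesis
    by blast
qed

end


section \<open>Sets of small upper Banach density\<close>

definition disjoint_translates :: "('g, 'b) monoid_scheme \<Rightarrow> 'g set \<Rightarrow> 'g set \<Rightarrow> bool" where
  "disjoint_translates G T S \<longleftrightarrow> disjoint_family_on (\<lambda>k. k <#\<^bsub>G\<^esub> S) T"

text \<open>The bound is uniform over the right translates of the Folner sets, because the Weyl
  pseudometric takes a supremum over these translates before the limit.\<close>

definition density_le :: "('g, 'b) monoid_scheme \<Rightarrow> (nat \<Rightarrow> 'g set) \<Rightarrow> 'g set \<Rightarrow> real \<Rightarrow> bool" where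
  "density_le G F S c \<longleftrightarrow>
     (\<forall>\<^sub>F n in sequentially. \<forall>g\<in>carrier G. real (card ((F n #>\<^bsub>G\<^esub> g) \<inter> S)) \<le> c * card (F n))"

context group
begin

text \<open>Each right coset of the intersection is the intersection of a coset of \<open>H\<close> with one of \<open>K\<close>, and
  there are only finitely many such pairs.\<close>

lemma finite_index_Int:
  assumes "finite_index_subgroup G H" "finite_index_subgroup G K"
  shows "finite_index_subgroup G (H \<inter> K)"
proof -
  have H: "subgroup H G" and K: "subgroup K G"
    using assms by (auto simp: finite_index_subgroup_def)
  have "(H \<inter> K) #> g = (H #> g) \<inter> (K #> g)" if "g \<in> carrier G" for g
  proof
    show "(H #> g) \<inter> (K #> g) \<subseteq> (H \<inter> K) #> g"
    proof
      fix x assume "x \<in> (H #> g) \<inter> (K #> g)"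
      then obtain h k where hk: "h \<in> H" "x = h \<otimes> g" "k \<in> K" "x = k \<otimes> g"
        unfolding r_coset_def by blast
      then have "h = k"
        using that subgroup.mem_carrier[OF H] subgroup.mem_carrier[OF K] right_cancel by metis
      then show "x \<in> (H \<inter> K) #> g"
        using hk unfolding r_coset_def by blast
    qed
  qed (auto simp: r_coset_def)
  then have "rcosets (H \<inter> K) \<subseteq> (\<lambda>(C, D). C \<inter> D) ` ((rcosets H) \<times> (rcosets K))"
    unfolding RCOSETS_def by force
  moreover have "finite ((rcosets H) \<times> (rcosets K))"
    using assms by (simp add: finite_index_subgroup_def)
  ultimately have "finite (rcosets (H \<inter> K))"
    using finite_surj by blast
  then show ?thesis
    using subgroups_Inter_pair[OF H K] by (simp add: finite_index_subgroup_def)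
qed

lemma l_coset_eq_image: "k <# E = (\<lambda>x. k \<otimes> x) ` E"
  by (auto simp: l_coset_def)

lemma card_l_coset:
  assumes "E \<subseteq> carrier G" "k \<in> carrier G"
  shows "card (k <# E) = card E"
  unfolding l_coset_eq_image
  by (rule card_image) (use assms in \<open>auto simp: inj_on_def subset_iff\<close>)

lemma r_coset_eq_image: "E #> g = (\<lambda>x. x \<otimes> g) ` E"
  by (auto simp: r_coset_def)

lemma inj_on_r_mult: "g \<in> carrier G \<Longrightarrow> inj_on (\<lambda>x. x \<otimes> g) (carrier G)"
  by (auto simp: inj_on_def)

lemma card_r_coset:
  assumes "E \<subseteq> carrier G" "g \<in> carrier G"
  shows "card (E #> g) = card E"
  unfolding r_coset_eq_image
  by (rule card_image) (use inj_on_r_mult[OF assms(2)] assms(1) inj_on_subset in blast)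

lemma l_coset_subset_carrier: "E \<subseteq> carrier G \<Longrightarrow> k \<in> carrier G \<Longrightarrow> k <# E \<subseteq> carrier G"
  by (auto simp: l_coset_def)

text \<open>Left and right translations commute, so almost invariance of a Folner set passes to all its
  right translates with the same error.\<close>

lemma r_coset_translation_defect:
  assumes E: "E \<subseteq> carrier G" and g: "g \<in> carrier G" and k: "k \<in> carrier G"
  shows "card (sym_diff (k <# (E #> g)) (E #> g)) = card (sym_diff (k <# E) E)"
proof -
  have kE: "k <# E \<subseteq> carrier G"
    using l_coset_subset_carrier E k by blast
  have "(\<lambda>x. k \<otimes> (x \<otimes> g)) ` E = (\<lambda>x. (k \<otimes> x) \<otimes> g) ` E"
    using E g k by (intro image_cong) (auto simp: m_assoc subset_iff)
  then have "k <# (E #> g) = (k <# E) #> g"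
    unfolding l_coset_eq_image r_coset_eq_image by (simp add: image_image)
  moreover have "sym_diff ((k <# E) #> g) (E #> g) = (sym_diff (k <# E) E) #> g"
    unfolding r_coset_eq_image image_Un
    using inj_on_image_set_diff[OF inj_on_r_mult[OF g], of "k <# E" E]
      inj_on_image_set_diff[OF inj_on_r_mult[OF g], of E "k <# E"] kE E by auto
  ultimately show ?thesis
    using card_r_coset[of "sym_diff (k <# E) E" g] kE E g by auto
qed

lemma l_coset_Int_card_le:
  assumes E: "E \<subseteq> carrier G" "finite E" and k: "k \<in> carrier G"
  shows "card ((k <# E) \<inter> S) \<le> card (E \<inter> S) + card (sym_diff (k <# E) E)"
proof -
  have fin: "finite (k <# E)"
    using E by (simp add: l_coset_def)
  have "card ((k <# E) \<inter> S) \<le> card ((E \<inter> S) \<union> sym_diff (k <# E) E)"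
    using E fin by (intro card_mono) auto
  then show ?thesis
    using card_Un_le order_trans by blast
qed

text \<open>Translating \<open>E \<inter> S\<close> by \<open>k\<close> lands in \<open>k <# S\<close>, and outside \<open>E\<close> only by the defect of \<open>E\<close> under \<open>k\<close>.
  The pieces \<open>E \<inter> (k <# S)\<close> are disjoint subsets of \<open>E\<close>, so their sizes add up to at most \<open>card E\<close>.\<close>

lemma disjoint_translates_card_le:
  assumes T: "finite T" "T \<subseteq> carrier G" and dis: "disjoint_translates G T S"
    and E: "finite E" "E \<subseteq> carrier G"
  shows "card T * card (E \<inter> S) \<le> card E + (\<Sum>k\<in>T. card (sym_diff (k <# E) E))"
proof -
  have "card (E \<inter> S) \<le> card (E \<inter> (k <# S)) + card (sym_diff (k <# E) E)" if k: "k \<in> T" for k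
  proof -
    have kG: "k \<in> carrier G"
      using T k by blast
    have "card (E \<inter> S) = card (k <# (E \<inter> S))"
      using card_l_coset[of "E \<inter> S" k] E kG by (metis le_infI1)
    also have "\<dots> \<le> card ((k <# E) \<inter> (k <# S))"
      using E by (intro card_mono) (auto simp: l_coset_def)
    also have "\<dots> \<le> card (E \<inter> (k <# S)) + card (sym_diff (k <# E) E)"
      using l_coset_Int_card_le[OF E(2,1) kG] .
    finally show ?thesis .
  qed
  then have "(\<Sum>k\<in>T. card (E \<inter> S)) \<le> (\<Sum>k\<in>T. card (E \<inter> (k <# S)) + card (sym_diff (k <# E) E))"
    by (rule sum_mono)
  moreover have "(\<Sum>k\<in>T. card (E \<inter> (k <# S))) = card (\<Union>k\<in>T. E \<inter> (k <# S))"
    using dis T E unfolding disjoint_translates_def disjoint_family_on_def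
    by (subst card_UN_disjoint) auto
  moreover have "card (\<Union>k\<in>T. E \<inter> (k <# S)) \<le> card E"
    using E by (intro card_mono) auto
  ultimately show ?thesis
    by (simp add: sum.distrib)
qed

lemma folner_eventually_almost_invariant:
  fixes \<delta> :: real
  assumes F: "folner_sequence G F" and T: "finite T" "T \<subseteq> carrier G" and \<delta>: "\<delta> > 0"
  shows "\<forall>\<^sub>F n in sequentially. \<forall>g\<in>carrier G. \<forall>k\<in>T.
     real (card (sym_diff (k <# (F n #> g)) (F n #> g))) \<le> \<delta> * card (F n)"
proof -
  have Fn: "F n \<noteq> {}" "finite (F n)" "F n \<subseteq> carrier G" for n
    using F by (auto simp: folner_sequence_def)
  have "\<forall>\<^sub>F n in sequentially. real (card (sym_diff (k <# F n) (F n))) \<le> \<delta> * card (F n)" if "k \<in> T" for k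
  proof -
    have "(\<lambda>n. real (card (sym_diff (k <# F n) (F n))) / real (card (F n))) \<longlonglongrightarrow> 0"
      using F that T by (auto simp: folner_sequence_def)
    then have "\<forall>\<^sub>F n in sequentially. real (card (sym_diff (k <# F n) (F n))) / real (card (F n)) < \<delta>"
      using \<delta> by (rule order_tendstoD(2))
    then show ?thesis
    proof eventually_elim
      case (elim n)
      have "0 < card (F n)"
        using Fn by (simp add: card_gt_0_iff)
      then show ?case
        using elim by (simp add: divide_less_eq)
    qed
  qed
  then have "\<forall>\<^sub>F n in sequentially. \<forall>k\<in>T. real (card (sym_diff (k <# F n) (F n))) \<le> \<delta> * card (F n)"
    using T(1) by (simp add: eventually_ball_finite)
  then show ?thesis
    using r_coset_translation_defect[OF Fn(3)] T(2) by (auto elim!: eventually_mono)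
qed

lemma disjoint_translates_density_le:
  fixes \<delta> :: real
  assumes F: "folner_sequence G F" and T: "finite T" "T \<subseteq> carrier G" "T \<noteq> {}"
    and dis: "disjoint_translates G T S" and \<delta>: "\<delta> > 0"
  shows "density_le G F S (1 / card T + \<delta>)"
proof -
  have Fn: "finite (F n)" "F n \<subseteq> carrier G" for n
    using F by (auto simp: folner_sequence_def)
  have cT: "0 < card T"
    using T by (simp add: card_gt_0_iff)
  show ?thesis
    unfolding density_le_def
    using folner_eventually_almost_invariant[OF F T(1,2) \<delta>]
  proof (eventually_elim, intro ballI)
    fix n g
    assume inv: "\<forall>g\<in>carrier G. \<forall>k\<in>T. real (card (sym_diff (k <# (F n #> g)) (F n #> g))) \<le> \<delta> * card (F n)"
      and g: "g \<in> carrier G"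
    define E where "E = F n #> g"
    have E: "finite E" "E \<subseteq> carrier G" "card E = card (F n)"
      using Fn[of n] g card_r_coset[of "F n" g] r_coset_subset_G[of "F n" g]
      unfolding E_def by (auto simp: r_coset_eq_image)
    have "real (card T * card (E \<inter> S)) \<le> real (card E + (\<Sum>k\<in>T. card (sym_diff (k <# E) E)))"
      using disjoint_translates_card_le[OF T(1,2) dis E(1,2)] of_nat_le_iff by blast
    also have "\<dots> \<le> card E + card T * (\<delta> * card (F n))"
      using inv g sum_bounded_above[of T "\<lambda>k. real (card (sym_diff (k <# E) E))"] unfolding E_def by simp
    finally show "real (card ((F n #> g) \<inter> S)) \<le> (1 / card T + \<delta>) * card (F n)"
      using cT E(3) unfolding E_def by (simp add: field_simps)
  qed
qed

text \<open>Needed because the distance of two shifted configurations depends on a whole window \<open>B\<close> of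
  coordinates, and the coordinate \<open>b\<close> of the configuration shifted by \<open>f\<close> is read at \<open>b \<otimes> f\<close>.\<close>

lemma density_le_translate:
  fixes c \<delta> :: real
  assumes F: "folner_sequence G F" and S: "density_le G F S c"
    and B: "finite B" "B \<subseteq> carrier G" and \<delta>: "\<delta> > 0"
  shows "\<forall>\<^sub>F n in sequentially. \<forall>g\<in>carrier G. \<forall>b\<in>B.
    real (card {f \<in> F n #> g. b \<otimes> f \<in> S}) \<le> (c + \<delta>) * card (F n)"
  using S[unfolded density_le_def] folner_eventually_almost_invariant[OF F B \<delta>]
proof (eventually_elim, intro ballI)
  fix n g b
  assume dens: "\<forall>g\<in>carrier G. real (card ((F n #> g) \<inter> S)) \<le> c * card (F n)"
    and inv: "\<forall>g\<in>carrier G. \<forall>k\<in>B. real (card (sym_diff (k <# (F n #> g)) (F n #> g))) \<le> \<delta> * card (F n)"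
    and g: "g \<in> carrier G" and b: "b \<in> B"
  define E where "E = F n #> g"
  have Fn: "finite (F n)" "F n \<subseteq> carrier G"
    using F by (auto simp: folner_sequence_def)
  have bG: "b \<in> carrier G"
    using b B by blast
  have E: "finite E" "E \<subseteq> carrier G"
    using Fn g r_coset_subset_G[of "F n" g] unfolding E_def by (auto simp: r_coset_eq_image)
  have "card {f \<in> E. b \<otimes> f \<in> S} = card (b <# {f \<in> E. b \<otimes> f \<in> S})"
    using card_l_coset[of "{f \<in> E. b \<otimes> f \<in> S}" b] E bG by (simp add: subset_iff)
  also have "\<dots> \<le> card ((b <# E) \<inter> S)"
    using E by (intro card_mono) (auto simp: l_coset_def)
  also have "\<dots> \<le> card (E \<inter> S) + card (sym_diff (b <# E) E)"
    using l_coset_Int_card_le[OF E(2,1) bG] .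
  finally have "real (card {f \<in> E. b \<otimes> f \<in> S}) \<le> real (card (E \<inter> S)) + real (card (sym_diff (b <# E) E))"
    by linarith
  also have "\<dots> \<le> c * card (F n) + \<delta> * card (F n)"
    using dens inv g b unfolding E_def by (intro add_mono) auto
  finally show "real (card {f \<in> F n #> g. b \<otimes> f \<in> S}) \<le> (c + \<delta>) * card (F n)"
    unfolding E_def by (simp add: algebra_simps)
qed

end


section \<open>The Weyl pseudometric\<close>

text \<open>Each \<open>x\<close> has a neighbourhood \<open>box x B\<close> of radius \<open>\<epsilon>/2\<close> that fixes the coordinates in a finite set
  \<open>B\<close>. Finitely many of these boxes cover the compact configuration space, and the union of
  their windows \<open>B\<close> works for all pairs at once, since configurations that agree on it lie in a common
  box.\<close>

lemma admissible_metric_finite_window: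
  fixes G :: "('g, 'b) monoid_scheme"
  assumes A: "finite A" and adm: "admissible_metric G A \<rho>" and \<epsilon>: "\<epsilon> > 0"
  shows "\<exists>B. finite B \<and> B \<subseteq> carrier G \<and>
    (\<forall>x\<in>configurations G A. \<forall>y\<in>configurations G A. (\<forall>b\<in>B. x b = y b) \<longrightarrow> \<rho> x y < \<epsilon>)"
proof -
  define X where "X = configurations G A"
  interpret M: Metric_space X \<rho>
    using adm by (simp add: admissible_metric_def X_def)
  have top: "M.mtopology = product_topology (\<lambda>_. discrete_topology A) (carrier G)"
    using adm by (simp add: admissible_metric_def X_def)
  have "compact_space (product_topology (\<lambda>_. discrete_topology A) (carrier G))"
    using A by (simp add: compact_space_product_topology compact_space_discrete_topology)
  then have comp: "compactin M.mtopology X"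
    using top by (metis M.topspace_mtopology compact_space_def)
  define box where "box x B = Pi\<^sub>E (carrier G) (\<lambda>i. if i \<in> B then {x i} else A)" for x B
  have "\<exists>B. finite B \<and> B \<subseteq> carrier G \<and> x \<in> box x B \<and> box x B \<subseteq> M.mball x (\<epsilon>/2)
      \<and> openin M.mtopology (box x B)" if x: "x \<in> X" for x
  proof -
    have "openin (product_topology (\<lambda>_. discrete_topology A) (carrier G)) (M.mball x (\<epsilon>/2))"
      using top M.openin_mball by metis
    moreover have "x \<in> M.mball x (\<epsilon>/2)"
      using x \<epsilon> by simp
    ultimately obtain V where V: "finite {i \<in> carrier G. V i \<noteq> A}" "x \<in> Pi\<^sub>E (carrier G) V"
        "Pi\<^sub>E (carrier G) V \<subseteq> M.mball x (\<epsilon>/2)"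
      unfolding openin_product_topology_alt topspace_discrete_topology by blast
    define B where "B = {i \<in> carrier G. V i \<noteq> A}"
    have B: "finite B" "B \<subseteq> carrier G"
      using V(1) by (auto simp: B_def)
    have xA: "x i \<in> A" if "i \<in> carrier G" for i
      using x that by (auto simp: X_def configurations_def)
    have "box x B \<subseteq> Pi\<^sub>E (carrier G) V"
      unfolding box_def B_def using V(2) by (intro PiE_mono) (auto simp: PiE_iff)
    moreover have "x \<in> box x B"
      using V(2) xA by (auto simp: box_def PiE_iff)
    moreover have "openin M.mtopology (box x B)"
      unfolding top box_def openin_PiE_gen
      using B xA by (auto elim: rev_finite_subset)
    ultimately show ?thesis
      using V(3) B by (intro exI[of _ B]) simp
  qed
  then obtain B where B: "\<And>x. x \<in> X \<Longrightarrow> finite (B x)" "\<And>x. x \<in> X \<Longrightarrow> B x \<subseteq> carrier G"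
    and own: "\<And>x. x \<in> X \<Longrightarrow> x \<in> box x (B x)"
    and small: "\<And>x. x \<in> X \<Longrightarrow> box x (B x) \<subseteq> M.mball x (\<epsilon>/2)"
    and op: "\<And>x. x \<in> X \<Longrightarrow> openin M.mtopology (box x (B x))"
    by metis
  have "\<exists>\<F>. finite \<F> \<and> \<F> \<subseteq> (\<lambda>x. box x (B x)) ` X \<and> X \<subseteq> \<Union>\<F>"
    by (rule compactinD[OF comp]) (use own op in auto)
  then obtain \<F> where \<F>: "finite \<F>" "\<F> \<subseteq> (\<lambda>x. box x (B x)) ` X" "X \<subseteq> \<Union>\<F>"
    by blast
  then obtain Y where Y: "finite Y" "Y \<subseteq> X" "X \<subseteq> (\<Union>w\<in>Y. box w (B w))"
    using finite_subset_image[OF \<F>(1,2)] by blast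
  have "\<rho> x y < \<epsilon>" if x: "x \<in> X" and y: "y \<in> X" and xy: "\<forall>b\<in>\<Union>(B ` Y). x b = y b" for x y
  proof -
    obtain w where w: "w \<in> Y" "x \<in> box w (B w)"
      using Y(3) x by blast
    have wX: "w \<in> X"
      using w Y(2) by blast
    have "y i = x i" if "i \<in> B w" for i
      using xy that w(1) by simp
    then have "y \<in> box w (B w)"
      using w(2) y by (auto simp: box_def X_def configurations_def PiE_iff)
    then have "\<rho> w x < \<epsilon>/2" "\<rho> w y < \<epsilon>/2"
      using small[OF wX] w(2) by auto
    then show ?thesis
      using M.triangle[OF x wX y] M.commute[of x w] by linarith
  qed
  moreover have "finite (\<Union>(B ` Y))" "\<Union>(B ` Y) \<subseteq> carrier G"
    using Y(1,2) B by auto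
  ultimately show ?thesis
    unfolding X_def[symmetric] by (intro exI[of _ "\<Union>(B ` Y)"]) simp
qed

lemma admissible_metric_le_1:
  assumes "admissible_metric G A \<rho>" "x \<in> configurations G A" "y \<in> configurations G A"
  shows "\<rho> x y \<le> 1"
  using assms unfolding admissible_metric_def by simp

lemma shift_in_configurations:
  assumes "group G" "h \<in> carrier G" "x \<in> configurations G A"
  shows "shift G h x \<in> configurations G A"
proof -
  interpret group G by fact
  show ?thesis
    using assms(2,3) by (auto simp: configurations_def shift_def)
qed

text \<open>Both bounds also require that the suprema and the upper limit are genuine: the suprema are
  over sets bounded by \<open>card (F n)\<close>, and the upper limit lies in \<open>[0, c]\<close>, hence is a real number.\<close>

lemma weyl_dist_bounds:
  fixes G :: "('g, 'b) monoid_scheme" (structure) and c :: real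
  assumes G: "group G" and adm: "admissible_metric G A \<rho>" and F: "folner_sequence G F"
    and x: "x \<in> configurations G A" and z: "z \<in> configurations G A"
    and le: "\<forall>\<^sub>F n in sequentially. \<forall>g\<in>carrier G.
      (\<Sum>f\<in>F n #>\<^bsub>G\<^esub> g. \<rho> (shift G f x) (shift G f z)) \<le> c * card (F n)"
  shows "0 \<le> weyl_dist G F \<rho> x z \<and> weyl_dist G F \<rho> x z \<le> c"
proof -
  interpret group G by fact
  interpret M: Metric_space "configurations G A" \<rho>
    using adm by (simp add: admissible_metric_def)
  define sm where "sm n g = (\<Sum>f\<in>F n #> g. \<rho> (shift G f x) (shift G f z))" for n g
  have Fn: "F n \<noteq> {}" "finite (F n)" "F n \<subseteq> carrier G" for n
    using F by (auto simp: folner_sequence_def)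
  have cF: "0 < card (F n)" for n
    using Fn by (simp add: card_gt_0_iff)
  have sm_nonneg: "0 \<le> sm n g" for n g
    unfolding sm_def by (rule sum_nonneg) simp
  have sm_le: "sm n g \<le> card (F n)" if g: "g \<in> carrier G" for n g
  proof -
    have "sm n g \<le> real (card (F n #> g)) * 1"
      unfolding sm_def
    proof (rule sum_bounded_above)
      fix f assume "f \<in> F n #> g"
      then have "f \<in> carrier G"
        using r_coset_subset_G[OF Fn(3) g] by blast
      then show "\<rho> (shift G f x) (shift G f z) \<le> 1"
        using admissible_metric_le_1[OF adm shift_in_configurations[OF G _ x] shift_in_configurations[OF G _ z]]
        by simp
    qed
    then show ?thesis
      using card_r_coset[OF Fn(3) g] by simp
  qed
  have sup_nonneg: "0 \<le> (SUP g\<in>carrier G. sm n g)" for n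
  proof -
    have "bdd_above (sm n ` carrier G)"
      using sm_le by (rule bdd_aboveI2)
    then show ?thesis
      using cSUP_upper[OF one_closed, of "sm n"] sm_nonneg[of n \<one>] by simp
  qed
  define u where "u n = ereal (1 / real (card (F n)) * (SUP g\<in>carrier G. sm n g))" for n
  have lower: "0 \<le> limsup u"
  proof -
    have "0 \<le> u n" for n
      using sup_nonneg[of n] by (simp add: u_def)
    then have "(0::ereal) \<le> liminf u"
      by (intro Liminf_bounded) simp
    then show ?thesis
      using Liminf_le_Limsup[of sequentially u] by simp
  qed
  have upper: "limsup u \<le> ereal c"
  proof (rule Limsup_bounded)
    show "\<forall>\<^sub>F n in sequentially. u n \<le> ereal c"
      using le
    proof eventually_elim
      case (elim n)
      have "(SUP g\<in>carrier G. sm n g) \<le> c * card (F n)"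
        using elim by (intro cSUP_least) (auto simp: sm_def)
      then show ?case
        using cF[of n] by (simp add: u_def divide_le_eq)
    qed
  qed
  have "weyl_dist G F \<rho> x z = real_of_ereal (limsup u)"
    unfolding weyl_dist_def u_def[abs_def] sm_def ..
  then show ?thesis
    using lower upper by (cases "limsup u") auto
qed

text \<open>A shift by \<open>f\<close> contributes at most \<open>\<eta>/2\<close> to the sum unless the window placed at \<open>f\<close> meets \<open>S\<close>, and
  then at most 1. The latter happens for a proportion of at most about \<open>card B\<close> times the density
  of \<open>S\<close>.\<close>

lemma weyl_dist_le_of_density:
  fixes G :: "('g, 'b) monoid_scheme" (structure) and \<eta> :: real
  assumes G: "group G" and A: "finite A" and adm: "admissible_metric G A \<rho>"
    and F: "folner_sequence G F" and \<eta>: "\<eta> > 0"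
  shows "\<exists>c>0. \<forall>S. \<forall>x\<in>configurations G A. \<forall>z\<in>configurations G A.
    density_le G F S c \<longrightarrow> {g \<in> carrier G. x g \<noteq> z g} \<subseteq> S \<longrightarrow>
    0 \<le> weyl_dist G F \<rho> x z \<and> weyl_dist G F \<rho> x z \<le> \<eta>"
proof -
  interpret group G by fact
  interpret M: Metric_space "configurations G A" \<rho>
    using adm by (simp add: admissible_metric_def)
  obtain B where B: "finite B" "B \<subseteq> carrier G"
    and win: "\<And>x y. \<lbrakk>x \<in> configurations G A; y \<in> configurations G A; \<forall>b\<in>B. x b = y b\<rbrakk> \<Longrightarrow> \<rho> x y < \<eta>/2"
    using admissible_metric_finite_window[OF A adm, of "\<eta>/2"] \<eta> by auto
  \<comment> \<open>One \<open>c\<close> bounds the density of \<open>S\<close>, the other the cost of translating by \<open>B\<close>; together they have to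
    satisfy \<open>card B * (c + c) \<le> \<eta>/2\<close>. The added 1 covers an empty window.\<close>
  define c where "c = \<eta> / (4 * (card B + 1))"
  have c: "c > 0"
    using \<eta> by (simp add: c_def)
  have "card B * (4 * c) \<le> \<eta>"
    unfolding c_def using \<eta> by (simp add: divide_le_eq)
  then have cB: "card B * (c + c) \<le> \<eta>/2"
    by simp
  have "0 \<le> weyl_dist G F \<rho> x z \<and> weyl_dist G F \<rho> x z \<le> \<eta>"
    if x: "x \<in> configurations G A" and z: "z \<in> configurations G A"
      and S: "density_le G F S c" and diff: "{g \<in> carrier G. x g \<noteq> z g} \<subseteq> S" for S x z
  proof (rule weyl_dist_bounds[OF G adm F x z])
    show "\<forall>\<^sub>F n in sequentially. \<forall>g\<in>carrier G.
      (\<Sum>f\<in>F n #> g. \<rho> (shift G f x) (shift G f z)) \<le> \<eta> * card (F n)"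
      using density_le_translate[OF F S B c]
    proof (eventually_elim, intro ballI)
      fix n g
      assume tr: "\<forall>g\<in>carrier G. \<forall>b\<in>B. real (card {f \<in> F n #> g. b \<otimes> f \<in> S}) \<le> (c + c) * card (F n)"
        and g: "g \<in> carrier G"
      define E where "E = F n #> g"
      have Fn: "finite (F n)" "F n \<subseteq> carrier G"
        using F by (auto simp: folner_sequence_def)
      have E: "finite E" "E \<subseteq> carrier G" "card E = card (F n)"
        using Fn g card_r_coset[of "F n" g] r_coset_subset_G[of "F n" g]
        unfolding E_def by (auto simp: r_coset_eq_image)
      have pointwise: "\<rho> (shift G f x) (shift G f z) \<le> \<eta>/2 + (\<Sum>b\<in>B. of_bool (b \<otimes> f \<in> S))" if "f \<in> E" for f
      proof -
        have f: "f \<in> carrier G"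
          using that E by blast
        note conf = shift_in_configurations[OF G f x] shift_in_configurations[OF G f z]
        show ?thesis
        proof (cases "\<exists>b\<in>B. b \<otimes> f \<in> S")
          case True
          then obtain b where b: "b \<in> B" "b \<otimes> f \<in> S"
            by blast
          have "1 \<le> (\<Sum>b\<in>B. of_bool (b \<otimes> f \<in> S) :: real)"
            using member_le_sum[of b B "\<lambda>b. of_bool (b \<otimes> f \<in> S) :: real"] b B(1) by simp
          moreover have "\<rho> (shift G f x) (shift G f z) \<le> 1"
            using admissible_metric_le_1[OF adm conf] .
          ultimately show ?thesis
            using \<eta> by linarith
        next
          case False
          have "shift G f x b = shift G f z b" if "b \<in> B" for b
            using that False diff B(2) f by (auto simp: shift_def)
          then have "\<rho> (shift G f x) (shift G f z) < \<eta>/2"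
            using win conf by blast
          moreover have "0 \<le> (\<Sum>b\<in>B. of_bool (b \<otimes> f \<in> S) :: real)"
            by (simp add: sum_nonneg)
          ultimately show ?thesis
            by linarith
        qed
      qed
      have "(\<Sum>f\<in>E. \<rho> (shift G f x) (shift G f z)) \<le> (\<Sum>f\<in>E. \<eta>/2 + (\<Sum>b\<in>B. of_bool (b \<otimes> f \<in> S)))"
        using pointwise by (rule sum_mono)
      also have "\<dots> = \<eta>/2 * card (F n) + (\<Sum>b\<in>B. \<Sum>f\<in>E. of_bool (b \<otimes> f \<in> S))"
        using E(3) by (simp add: sum.distrib sum.swap[of _ B E])
      also have "(\<Sum>b\<in>B. \<Sum>f\<in>E. of_bool (b \<otimes> f \<in> S) :: real) = (\<Sum>b\<in>B. card {f \<in> E. b \<otimes> f \<in> S})"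
        using E(1) by (simp add: Int_def)
      also have "\<dots> \<le> card B * ((c + c) * card (F n))"
        using tr g unfolding E_def of_nat_sum by (intro sum_bounded_above) auto
      also have "\<dots> \<le> \<eta>/2 * card (F n)"
        using mult_right_mono[OF cB, of "card (F n)"] by (simp add: mult.assoc)
      finally show "(\<Sum>f\<in>F n #> g. \<rho> (shift G f x) (shift G f z)) \<le> \<eta> * card (F n)"
        unfolding E_def by simp
    qed
  qed
  then show ?thesis
    using c by blast
qed


section \<open>Interpolating between two Toeplitz configurations\<close>

context residual_chain
begin

definition interpolate :: "('a \<Rightarrow> 'c) \<Rightarrow> ('a \<Rightarrow> 'c) \<Rightarrow> real \<Rightarrow> 'a \<Rightarrow> 'c" where
  "interpolate z z' t = (\<lambda>g\<in>carrier G. if height g < t then z' g else z g)"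

lemma interpolate_endpoints:
  assumes "z \<in> configurations G A" "z' \<in> configurations G A"
  shows "interpolate z z' 0 = z" "interpolate z z' 1 = z'"
proof -
  have "z = restrict z (carrier G)" "z' = restrict z' (carrier G)"
    using assms by (simp_all add: configurations_def PiE_restrict)
  moreover have "interpolate z z' 0 = restrict z (carrier G)" "interpolate z z' 1 = restrict z' (carrier G)"
    unfolding interpolate_def using height_bounds by (fastforce intro!: restrict_ext)+
  ultimately show "interpolate z z' 0 = z" "interpolate z z' 1 = z'"
    by simp_all
qed

text \<open>Near \<open>g\<close> the interpolant coincides with one of the two configurations, so a period of that
  configuration at \<open>g\<close>, intersected with a deep enough \<open>N n\<close>, is a period of the interpolant.\<close>

lemma interpolate_toeplitz:
  assumes z: "z \<in> toeplitz G A" and z': "z' \<in> toeplitz G A"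
  shows "interpolate z z' t \<in> toeplitz G A"
proof -
  have "\<exists>H. finite_index_subgroup G H \<and>
      (\<forall>\<gamma>\<in>H. interpolate z z' t (\<gamma> \<otimes> g) = interpolate z z' t g)" if g: "g \<in> carrier G" for g
  proof -
    define y where "y = (if height g < t then z' else z)"
    obtain H where H: "finite_index_subgroup G H" "\<And>\<gamma>. \<gamma> \<in> H \<Longrightarrow> y (\<gamma> \<otimes> g) = y g"
      using z z' g unfolding toeplitz_def y_def by (cases "height g < t") (simp_all, blast+)
    obtain n where n: "\<And>h. h \<in> N n #> g \<Longrightarrow> height h < t \<longleftrightarrow> height g < t"
      using height_locally_decided[OF g] by blast
    have "interpolate z z' t (\<gamma> \<otimes> g) = interpolate z z' t g" if \<gamma>: "\<gamma> \<in> N n \<inter> H" for \<gamma>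
    proof -
      have mem: "\<gamma> \<otimes> g \<in> N n #> g"
        using \<gamma> by (auto simp: r_coset_def)
      then have "interpolate z z' t (\<gamma> \<otimes> g) = y (\<gamma> \<otimes> g)"
        using n[OF mem] coset_carrier[OF mem g] by (simp add: interpolate_def y_def)
      also have "\<dots> = interpolate z z' t g"
        using H(2) \<gamma> g by (simp add: interpolate_def y_def)
      finally show ?thesis .
    qed
    then show ?thesis
      using finite_index_Int[OF finite_index H(1)] by blast
  qed
  moreover have "interpolate z z' t \<in> configurations G A"
    using z z' by (auto simp: interpolate_def toeplitz_def configurations_def)
  ultimately show ?thesis
    by (simp add: toeplitz_def)
qed

text \<open>Choose \<open>n\<close> so that the elements of \<open>T\<close> lie in different left cosets of \<open>N n\<close>. A set whose heights
  differ little lies in a single right coset \<open>N n #> g\<close>, and its translate by \<open>k\<close> lies in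
  \<open>(k <# N n) #> g\<close>.\<close>

lemma height_band_disjoint_translates:
  assumes T: "finite T" "T \<subseteq> carrier G"
  shows "\<exists>\<epsilon>>0. \<forall>S\<subseteq>carrier G. (\<forall>g\<in>S. \<forall>h\<in>S. \<bar>height g - height h\<bar> < \<epsilon>) \<longrightarrow> disjoint_translates G T S"
proof -
  obtain n where n: "(\<lambda>(k, l). inv l \<otimes> k) ` (T \<times> T) \<inter> N n \<subseteq> {\<one>}"
    using finite_escapes[of "(\<lambda>(k, l). inv l \<otimes> k) ` (T \<times> T)"] T(1) by auto
  obtain \<epsilon> where \<epsilon>: "\<epsilon> > 0"
      "\<And>g h. \<lbrakk>g \<in> carrier G; h \<in> carrier G; \<bar>height g - height h\<bar> < \<epsilon>\<rbrakk> \<Longrightarrow> g \<in> N n #> h"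
    using height_close_imp_same_coset[of n] by blast
  have "disjoint_translates G T S"
    if S: "S \<subseteq> carrier G" "\<And>g h. g \<in> S \<Longrightarrow> h \<in> S \<Longrightarrow> \<bar>height g - height h\<bar> < \<epsilon>" for S
  proof -
    have "k = l" if kl: "k \<in> T" "l \<in> T" and gh: "g \<in> S" "h \<in> S" and eq: "k \<otimes> g = l \<otimes> h" for k l g h
    proof -
      have car: "k \<in> carrier G" "l \<in> carrier G" "g \<in> carrier G" "h \<in> carrier G"
        using kl gh T S by auto
      have "h \<in> N n #> g"
        using \<epsilon>(2) S(2) gh car by blast
      then have "h \<otimes> inv g \<in> N n"
        using subgroup.rcos_module_imp[OF subgroup_N is_group] car by blast
      moreover have "h = inv l \<otimes> (k \<otimes> g)"
        using car by (simp add: eq m_assoc[symmetric])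
      then have "h \<otimes> inv g = inv l \<otimes> k"
        using car by (simp add: m_assoc)
      ultimately have "inv l \<otimes> k = \<one>"
        using n kl by force
      moreover have "k = l \<otimes> (inv l \<otimes> k)"
        using car by (simp add: m_assoc[symmetric])
      ultimately show ?thesis
        using car by simp
    qed
    then show ?thesis
      unfolding disjoint_translates_def disjoint_family_on_def l_coset_def by blast
  qed
  then show ?thesis
    using \<epsilon>(1) by (intro exI[of _ \<epsilon>]) simp
qed

lemma height_band_density_le:
  assumes F: "folner_sequence G F" and inf: "infinite (carrier G)" and c: "c > 0"
  shows "\<exists>\<epsilon>>0. \<forall>S\<subseteq>carrier G. (\<forall>g\<in>S. \<forall>h\<in>S. \<bar>height g - height h\<bar> < \<epsilon>) \<longrightarrow> density_le G F S c"
proof -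
  obtain m where m: "inverse (real (Suc m)) < c"
    using reals_Archimedean[OF c] by blast
  obtain T where T: "finite T" "card T = Suc m" "T \<subseteq> carrier G"
    using infinite_arbitrarily_large[OF inf] by blast
  have le: "density_le G F S c" if "disjoint_translates G T S" for S
  proof -
    have "density_le G F S (1 / card T + (c - 1 / card T))"
      using that T m c
      by (intro disjoint_translates_density_le[OF F]) (auto simp: inverse_eq_divide)
    then show ?thesis
      by simp
  qed
  show ?thesis
    using height_band_disjoint_translates[OF T(1,3)] by (elim ex_forward) (use le in blast)
qed

lemma interpolate_continuous:
  assumes F: "folner_sequence G F" and inf: "infinite (carrier G)" and A: "finite A"
    and adm: "admissible_metric G A \<rho>"
    and z: "z \<in> toeplitz G A" and z': "z' \<in> toeplitz G A"
  shows "pseudometric_continuous_on T (weyl_dist G F \<rho>) (interpolate z z')"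
  unfolding pseudometric_continuous_on_def
proof (intro ballI tendstoI)
  fix t and r :: real assume r: "r > 0"
  obtain c where c: "c > 0" and near: "\<And>S x y. \<lbrakk>x \<in> configurations G A; y \<in> configurations G A;
      density_le G F S c; {g \<in> carrier G. x g \<noteq> y g} \<subseteq> S\<rbrakk>
      \<Longrightarrow> 0 \<le> weyl_dist G F \<rho> x y \<and> weyl_dist G F \<rho> x y \<le> r/2"
    using weyl_dist_le_of_density[OF is_group A adm F, of "r/2"] r by auto
  obtain \<epsilon> where \<epsilon>: "\<epsilon> > 0" and dens: "\<forall>S\<subseteq>carrier G.
      (\<forall>g\<in>S. \<forall>h\<in>S. \<bar>height g - height h\<bar> < \<epsilon>) \<longrightarrow> density_le G F S c"
    using height_band_density_le[OF F inf c] by blast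
  have "dist (weyl_dist G F \<rho> (interpolate z z' s) (interpolate z z' t)) 0 < r"
    if st: "dist s t < \<epsilon>" for s
  proof -
    define S where "S = {g \<in> carrier G. min s t \<le> height g \<and> height g < max s t}"
    have "\<bar>height g - height h\<bar> < \<epsilon>" if "g \<in> S" "h \<in> S" for g h
      using that st unfolding S_def dist_real_def by (auto simp: min_def max_def split: if_splits)
    moreover have "S \<subseteq> carrier G"
      by (auto simp: S_def)
    ultimately have "density_le G F S c"
      using dens by blast
    moreover have "{g \<in> carrier G. interpolate z z' s g \<noteq> interpolate z z' t g} \<subseteq> S"
      unfolding S_def interpolate_def by (auto split: if_splits)
    moreover have "interpolate z z' u \<in> configurations G A" for u
      using interpolate_toeplitz[OF z z'] by (simp add: toeplitz_def)
    ultimately show ?thesis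
      using near[of "interpolate z z' s" "interpolate z z' t" S] r by (simp add: dist_real_def)
  qed
  then show "\<forall>\<^sub>F s in at t within T.
      dist (weyl_dist G F \<rho> (interpolate z z' s) (interpolate z z' t)) 0 < r"
    using \<epsilon> unfolding eventually_at by blast
qed

end


section \<open>Path-connectedness\<close>

theorem theorem55:
  fixes G :: "('g, 'b) monoid_scheme"
    and A :: "'a set"
    and \<rho> :: "('g \<Rightarrow> 'a) \<Rightarrow> ('g \<Rightarrow> 'a) \<Rightarrow> real"
    and F :: "nat \<Rightarrow> 'g set"
    and z z' :: "'g \<Rightarrow> 'a"
  assumes "group G"
    and "countable (carrier G)"
    and "infinite (carrier G)"
    and "amenable G"
    and "residually_finite G"
    and "finite A"
    and "admissible_metric G A \<rho>"
    and "folner_sequence G F"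
    and "z \<in> toeplitz G A"
    and "z' \<in> toeplitz G A"
  shows "\<exists>f :: real \<Rightarrow> 'g \<Rightarrow> 'a.
           (\<forall>t\<in>{0..1}. f t \<in> toeplitz G A) \<and>
           pseudometric_continuous_on {0..1} (weyl_dist G F \<rho>) f \<and>
           f 0 = z \<and> f 1 = z'"
proof -
  interpret group G by fact
  obtain N where N: "\<forall>n. N n \<lhd> G \<and> finite_index_subgroup G (N n)"
      "\<forall>n. N (Suc n) \<subseteq> N n" "(\<Inter>n. N n) = {\<one>\<^bsub>G\<^esub>}"
    using \<open>residually_finite G\<close> unfolding residually_finite_def by (elim exE conjE)
  define e where "e = from_nat_into (carrier G)"
  have "range e = carrier G"
    unfolding e_def using \<open>countable (carrier G)\<close> one_closed by (intro range_from_nat_into) auto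
  then interpret residual_chain G N e
    using N by unfold_locales simp_all
  have "z \<in> configurations G A" "z' \<in> configurations G A"
    using \<open>z \<in> toeplitz G A\<close> \<open>z' \<in> toeplitz G A\<close> by (auto simp: toeplitz_def)
  then have "interpolate z z' 0 = z" "interpolate z z' 1 = z'"
    by (rule interpolate_endpoints)+
  moreover have "interpolate z z' t \<in> toeplitz G A" for t
    using \<open>z \<in> toeplitz G A\<close> \<open>z' \<in> toeplitz G A\<close> by (rule interpolate_toeplitz)
  moreover have "pseudometric_continuous_on {0..1} (weyl_dist G F \<rho>) (interpolate z z')"
    by (rule interpolate_continuous) fact+
  ultimately show ?thesis
    by (intro exI[of _ "interpolate z z'"]) simp
qed

end
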